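(* If $(U,R,\mathcal F)$ is an sL-approximation space, then the dcpo $(\mathfrak C(U,R,\mathcal F),\subseteq)$ of its CF-closed sets is an sL-domain.
   Context: Upper approximation: for a set $U$, a binary relation $R$ on $U$ and $A\subseteq U$, put $\overline R(A)=\{x\in U\mid \exists y\in A,\ xRy\}$. $K\subseteq_{fin}X$ means that $K$ is a finite (possibly empty) subset of $X$, and $\mathcal P_{fin}(U)$ is the set of all finite subsets of $U$. CF-approximation space: a triple $(U,R,\mathcal F)$ with $R$ a transitive relation on the set $U$ and $\emptyset\neq\mathcal F\subseteq\mathcal P_{fin}(U)$ such that for every $F\in\mathcal F$ and every $K\subseteq_{fin}\overline R(F)$ there is $G\in\mathcal F$ with $K\subseteq\overline R(G)$ and $G\subseteq\overline R(F)$. CF-closed set: $E\subseteq U$ such that for every $K\subseteq_{fin}E$ there is $F\in\mathcal F$ with $K\subseteq\overline R(F)\subseteq E$ and $F\subseteq E$. $\mathfrak C(U,R,\mathcal F)$ is the set of all CF-closed sets; ordered by inclusion it is a dcpo. Join saturation: $\mathcal F^{\sharp}$ is the set of all unions $\bigcup\mathcal A$ of nonempty finite subfamilies $\mathcal A\subseteq\mathcal F$. sL-approximation space: a CF-approximation space $(U,R,\mathcal F)$ such that for all $M\in\mathcal F^{\sharp}$ and $F\in\mathcal F$ with $M\subseteq\overline R(F)$ there is $G\in\mathcal F$ satisfying: (sL-1) $\overline R(M)\subseteq\overline R(G)\subseteq\overline R(F)$; and (sL-2) for all $G'\in\mathcal F$, $\overline R(M)\subseteq\overline R(G')\subseteq\overline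 R(F)$ implies $\overline R(G)\subseteq\overline R(G')$. Domains: directed sets are nonempty; a dcpo is a poset in which every directed subset has a supremum. $x\ll y$ means that for every directed $D$ having a supremum with $\sup D\geqslant y$ there is $d\in D$ with $x\leqslant d$. A continuous domain is a dcpo in which, for every $x$, the set $\{y\mid y\ll x\}$ is directed with supremum $x$. A sup-semilattice is a poset in which every pair of elements has a supremum. An sL-domain is a continuous domain $L$ such that for every $x\in L$ the principal ideal ${\downarrow}x=\{y\in L\mid y\leqslant x\}$, with the inherited order, is a sup-semilattice. *)

theory Defs
  imports "HOL-Algebra.Lattice"
begin

section \<open>Domains\<close>

text \<open>
  Posets are the partial orders of \<^theory>\<open>HOL-Algebra.Order\<close>, with an explicit carrier;
  \<^term>\<open>is_lub L s D\<close> says that \<open>s\<close> is the supremum of \<open>D\<close> in \<open>L\<close>. That abbreviation only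
  constrains \<^term>\<open>D \<inter> carrier L\<close>, so the subsets considered below are always required to
  lie in the carrier.
\<close>

definition directed_in :: "('a, 'b) gorder_scheme \<Rightarrow> 'a set \<Rightarrow> bool" where
  "directed_in L D \<longleftrightarrow> D \<subseteq> carrier L \<and> D \<noteq> {} \<and>
     (\<forall>x\<in>D. \<forall>y\<in>D. \<exists>z\<in>D. x \<sqsubseteq>\<^bsub>L\<^esub> z \<and> y \<sqsubseteq>\<^bsub>L\<^esub> z)"

definition way_below :: "('a, 'b) gorder_scheme \<Rightarrow> 'a \<Rightarrow> 'a \<Rightarrow> bool" where
  "way_below L x y \<longleftrightarrow> x \<in> carrier L \<and> y \<in> carrier L \<and>
     (\<forall>D s. directed_in L D \<and> is_lub L s D \<and> y \<sqsubseteq>\<^bsub>L\<^esub> s \<longrightarrow> (\<exists>d\<in>D. x \<sqsubseteq>\<^bsub>L\<^esub> d))"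

locale dcpo = partial_order L for L (structure) +
  assumes directed_lub_exists: "directed_in L D \<Longrightarrow> \<exists>s. is_lub L s D"

locale continuous_domain = dcpo L for L (structure) +
  assumes way_below_directed: "x \<in> carrier L \<Longrightarrow> directed_in L {y. way_below L y x}"
    and way_below_lub: "x \<in> carrier L \<Longrightarrow> is_lub L x {y. way_below L y x}"

definition principal_ideal_order :: "('a, 'b) gorder_scheme \<Rightarrow> 'a \<Rightarrow> ('a, 'b) gorder_scheme" where
  "principal_ideal_order L x = L\<lparr>carrier := {y \<in> carrier L. y \<sqsubseteq>\<^bsub>L\<^esub> x}\<rparr>"

locale sL_domain = continuous_domain L for L (structure) +
  assumes principal_ideal_semilattice:
    "x \<in> carrier L \<Longrightarrow> upper_semilattice (principal_ideal_order L x)"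


section \<open>CF-approximation spaces\<close>

definition upper_approx :: "'a set \<Rightarrow> ('a \<times> 'a) set \<Rightarrow> 'a set \<Rightarrow> 'a set" where
  "upper_approx U R A = {x \<in> U. \<exists>y\<in>A. (x, y) \<in> R}"

locale CF_approximation_space =
  fixes U :: "'a set" and R :: "('a \<times> 'a) set" and F :: "'a set set"
  assumes rel_on: "R \<subseteq> U \<times> U"
    and rel_trans: "trans R"
    and family_nonempty: "F \<noteq> {}"
    and family_finite_subsets: "F \<subseteq> Fpow U"
    and interpolation:
      "A \<in> F \<Longrightarrow> finite K \<Longrightarrow> K \<subseteq> upper_approx U R A \<Longrightarrow>
        \<exists>G\<in>F. K \<subseteq> upper_approx U R G \<and> G \<subseteq> upper_approx U R A"

definition CF_closed :: "'a set \<Rightarrow> ('a \<times> 'a) set \<Rightarrow> 'a set set \<Rightarrow> 'a set \<Rightarrow> bool" where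
  "CF_closed U R F E \<longleftrightarrow> E \<subseteq> U \<and>
     (\<forall>K. finite K \<and> K \<subseteq> E \<longrightarrow>
        (\<exists>A\<in>F. K \<subseteq> upper_approx U R A \<and> upper_approx U R A \<subseteq> E \<and> A \<subseteq> E))"

definition CF_closed_order :: "'a set \<Rightarrow> ('a \<times> 'a) set \<Rightarrow> 'a set set \<Rightarrow> 'a set gorder" where
  "CF_closed_order U R F = \<lparr>carrier = {E. CF_closed U R F E}, eq = (=), le = (\<subseteq>)\<rparr>"

definition join_saturation :: "'a set set \<Rightarrow> 'a set set" where
  "join_saturation F = {\<Union>\<A> |\<A>. \<A> \<subseteq> F \<and> finite \<A> \<and> \<A> \<noteq> {}}"

locale sL_approximation_space = CF_approximation_space U R F
  for U :: "'a set" and R :: "('a \<times> 'a) set" and F :: "'a set set" +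
  assumes sL:
    "M \<in> join_saturation F \<Longrightarrow> A \<in> F \<Longrightarrow> M \<subseteq> upper_approx U R A \<Longrightarrow>
      \<exists>G\<in>F.
        (upper_approx U R M \<subseteq> upper_approx U R G \<and> upper_approx U R G \<subseteq> upper_approx U R A) \<and>
        (\<forall>G'\<in>F. upper_approx U R M \<subseteq> upper_approx U R G' \<and>
                 upper_approx U R G' \<subseteq> upper_approx U R A \<longrightarrow>
                 upper_approx U R G \<subseteq> upper_approx U R G')"

end

theory Submission
  imports Defs
begin

text \<open>
  Every CF-closed set \<open>E\<close> is the directed union of the sets \<open>upper_approx U R A\<close> with
  \<open>A \<in> F\<close> and \<open>A \<subseteq> E\<close>, each of which is way below \<open>E\<close>; this gives continuity.

  For suprema below a CF-closed set \<open>X\<close>, condition sL yields for each finite \<open>M \<subseteq> X\<close> in the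
  join saturation a least \<open>upper_approx U R G\<close> above \<open>upper_approx U R M\<close> inside
  \<open>upper_approx U R B\<close>, where \<open>B \<subseteq> X\<close>. Since the admissible \<open>B\<close> are directed, this least set
  does not depend on \<open>B\<close>. The supremum of \<open>E\<^sub>1\<close> and \<open>E\<^sub>2\<close> below \<open>X\<close> is the directed union of
  these sets for \<open>M = A\<^sub>1 \<union> A\<^sub>2\<close> with \<open>A\<^sub>1 \<subseteq> E\<^sub>1\<close> and \<open>A\<^sub>2 \<subseteq> E\<^sub>2\<close>.
\<close>

section \<open>The inclusion order on CF-closed sets\<close>

lemma upper_approx_Un:
  "upper_approx U R (A \<union> B) = upper_approx U R A \<union> upper_approx U R B"
  unfolding upper_approx_def by blast

lemma carrier_CF_closed_order [simp]:
  "carrier (CF_closed_order U R F) = {E. CF_closed U R F E}"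
  by (simp add: CF_closed_order_def)

lemma le_CF_closed_order [simp]:
  "E \<sqsubseteq>\<^bsub>CF_closed_order U R F\<^esub> E' \<longleftrightarrow> E \<subseteq> E'"
  by (simp add: CF_closed_order_def)

lemma eq_CF_closed_order [simp]:
  "(.=\<^bsub>CF_closed_order U R F\<^esub>) = (=)"
  by (simp add: CF_closed_order_def)

lemma partial_order_CF_closed_order: "partial_order (CF_closed_order U R F)"
  by unfold_locales auto

lemma partial_order_principal_ideal_order:
  assumes "partial_order L"
  shows "partial_order (principal_ideal_order L x)"
proof -
  interpret partial_order L by fact
  show ?thesis
    unfolding principal_ideal_order_def
    by unfold_locales (auto intro: sym trans le_trans simp: eq_is_equal)
qed

text \<open>\<open>Upper\<close> only tests members of \<open>D\<close> that lie in the carrier;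
  with all of them CF-closed, the condition ranges over the whole of \<open>D\<close>.\<close>

lemma is_lub_CF_closed_order_iff:
  assumes "\<And>E. E \<in> D \<Longrightarrow> CF_closed U R F E"
  shows "is_lub (CF_closed_order U R F) S D \<longleftrightarrow>
    CF_closed U R F S \<and> (\<forall>E\<in>D. E \<subseteq> S) \<and>
    (\<forall>T. CF_closed U R F T \<and> (\<forall>E\<in>D. E \<subseteq> T) \<longrightarrow> S \<subseteq> T)"
proof -
  have "Upper (CF_closed_order U R F) D = {T. CF_closed U R F T \<and> (\<forall>E\<in>D. E \<subseteq> T)}"
    using assms unfolding Upper_def by auto
  then show ?thesis unfolding least_def by auto
qed

section \<open>Directed unions of CF-closed sets\<close>

lemma finite_subset_directed_Union:
  assumes "finite K" "K \<subseteq> \<Union>D" "D \<noteq> {}"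
    and "\<And>E E'. E \<in> D \<Longrightarrow> E' \<in> D \<Longrightarrow> \<exists>E''\<in>D. E \<subseteq> E'' \<and> E' \<subseteq> E''"
  shows "\<exists>E\<in>D. K \<subseteq> E"
  using assms(1,2)
proof (induction K)
  case empty
  then show ?case using \<open>D \<noteq> {}\<close> by blast
next
  case (insert x K)
  then obtain E E' where "E \<in> D" "K \<subseteq> E" "E' \<in> D" "x \<in> E'" by auto
  with assms(4)[of E E'] show ?case by blast
qed

text \<open>CF-closedness is a condition on finite subsets: by directedness a finite
  \<open>K\<close> lies in one member of \<open>D\<close>, and the witness for that member serves
  the union. Nonemptiness of \<open>D\<close> covers \<open>K = {}\<close>.\<close>

lemma CF_closed_directed_Union:
  assumes closed: "\<And>E. E \<in> D \<Longrightarrow> CF_closed U R F E" and "D \<noteq> {}"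
    and "\<And>E E'. E \<in> D \<Longrightarrow> E' \<in> D \<Longrightarrow> \<exists>E''\<in>D. E \<subseteq> E'' \<and> E' \<subseteq> E''"
  shows "CF_closed U R F (\<Union>D)"
  unfolding CF_closed_def
proof (intro conjI allI impI)
  show "\<Union>D \<subseteq> U" using closed unfolding CF_closed_def by blast
next
  fix K assume K: "finite K \<and> K \<subseteq> \<Union>D"
  with finite_subset_directed_Union[of K D] assms(2,3) obtain E where E: "E \<in> D" "K \<subseteq> E"
    by blast
  with K closed obtain A where
    "A \<in> F" "K \<subseteq> upper_approx U R A" "upper_approx U R A \<subseteq> E" "A \<subseteq> E"
    unfolding CF_closed_def by meson
  with E show "\<exists>A\<in>F. K \<subseteq> upper_approx U R A \<and> upper_approx U R A \<subseteq> \<Union>D \<and> A \<subseteq> \<Union>D"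
    by blast
qed

lemma CF_closed_directed_is_lub_Union:
  assumes "directed_in (CF_closed_order U R F) D"
  shows "is_lub (CF_closed_order U R F) (\<Union>D) D"
proof -
  have closed: "\<And>E. E \<in> D \<Longrightarrow> CF_closed U R F E"
    using assms unfolding directed_in_def by auto
  have "CF_closed U R F (\<Union>D)"
    using assms by (intro CF_closed_directed_Union) (auto simp: directed_in_def)
  then show ?thesis using is_lub_CF_closed_order_iff[of D, OF closed] by blast
qed

lemma dcpo_CF_closed_order: "dcpo (CF_closed_order U R F)"
proof -
  interpret partial_order "CF_closed_order U R F" by (rule partial_order_CF_closed_order)
  show ?thesis by unfold_locales (blast intro: CF_closed_directed_is_lub_Union)
qed

lemma CF_closed_upper_approxE:
  assumes "CF_closed U R F E" "finite K" "K \<subseteq> E"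
  obtains A where "A \<in> F" "K \<subseteq> upper_approx U R A" "upper_approx U R A \<subseteq> E" "A \<subseteq> E"
  using assms unfolding CF_closed_def by meson

text \<open>The case \<open>K = {}\<close> of CF-closedness; it keeps the approximating families
  nonempty, even for an empty \<open>E\<close>.\<close>

lemma CF_closed_family_memberE:
  assumes "CF_closed U R F E"
  obtains A where "A \<in> F" "A \<subseteq> E"
  by (rule CF_closed_upper_approxE[OF assms finite.emptyI]) auto

section \<open>The way-below relation and continuity\<close>

context CF_approximation_space
begin

lemma finite_family: "A \<in> F \<Longrightarrow> finite A"
  using family_finite_subsets unfolding Fpow_def by blast

lemma upper_approx_absorb:
  assumes "A \<subseteq> upper_approx U R B"
  shows "upper_approx U R A \<subseteq> upper_approx U R B"
  using assms rel_trans unfolding upper_approx_def by (blast dest: transD)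

text \<open>Interpolation provides the witness \<open>G\<close> for a finite \<open>K\<close>, and
  transitivity puts the approximation of \<open>G\<close> inside that of \<open>A\<close>.\<close>

lemma CF_closed_upper_approx:
  assumes "A \<in> F"
  shows "CF_closed U R F (upper_approx U R A)"
  unfolding CF_closed_def
proof (intro conjI allI impI)
  show "upper_approx U R A \<subseteq> U" unfolding upper_approx_def by blast
next
  fix K assume "finite K \<and> K \<subseteq> upper_approx U R A"
  then show "\<exists>G\<in>F. K \<subseteq> upper_approx U R G \<and>
      upper_approx U R G \<subseteq> upper_approx U R A \<and> G \<subseteq> upper_approx U R A"
    using interpolation[OF assms] upper_approx_absorb by meson
qed

text \<open>Members of \<open>F\<close> are finite, so \<open>K = A\<close> is allowed: it puts
  \<open>A\<close> inside the approximation of some \<open>B\<close>, which lies in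
  \<open>E\<close>, and transitivity absorbs the approximation of \<open>A\<close> into that of
  \<open>B\<close>.\<close>

lemma upper_approx_subset_CF_closed:
  assumes "CF_closed U R F E" "A \<in> F" "A \<subseteq> E"
  shows "upper_approx U R A \<subseteq> E"
  using CF_closed_upper_approxE[OF assms(1) finite_family assms(3)] assms(2)
    upper_approx_absorb by (metis subset_trans)

text \<open>CF-closedness is applied to the finite set \<open>A \<union> B\<close>. Later
  directedness arguments all rest on this.\<close>

lemma CF_closed_family_directed:
  assumes "CF_closed U R F E" "A \<in> F" "A \<subseteq> E" "B \<in> F" "B \<subseteq> E"
  obtains G where "G \<in> F" "G \<subseteq> E" "A \<subseteq> upper_approx U R G" "B \<subseteq> upper_approx U R G"
proof -
  have "finite (A \<union> B)" "A \<union> B \<subseteq> E" using assms finite_family by auto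
  with assms(1) obtain G where "G \<in> F" "A \<union> B \<subseteq> upper_approx U R G" "G \<subseteq> E"
    by (rule CF_closed_upper_approxE)
  then show thesis using that by simp
qed

lemma CF_closed_elemE:
  assumes "CF_closed U R F E" "x \<in> E"
  obtains A where "A \<in> F" "A \<subseteq> E" "x \<in> upper_approx U R A"
proof -
  from assms have "finite {x}" "{x} \<subseteq> E" by auto
  with assms(1) obtain A where "A \<in> F" "{x} \<subseteq> upper_approx U R A" "A \<subseteq> E"
    by (rule CF_closed_upper_approxE)
  then show thesis using that by simp
qed

text \<open>One direction tests the relation on the directed family of approximations filling
  \<open>E\<close>; the other uses that a finite \<open>A\<close> inside a directed union lies in a
  single member.\<close>

lemma way_below_CF_closed_order_iff:
  assumes E: "CF_closed U R F E"
  shows "way_below (CF_closed_order U R F) E' E \<longleftrightarrow>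
    CF_closed U R F E' \<and> (\<exists>A\<in>F. A \<subseteq> E \<and> E' \<subseteq> upper_approx U R A)"
proof
  assume wb: "way_below (CF_closed_order U R F) E' E"
  define D where "D = {upper_approx U R A | A. A \<in> F \<and> A \<subseteq> E}"
  have "D \<noteq> {}"
    using E by (rule CF_closed_family_memberE) (auto simp: D_def)
  moreover have "\<exists>Z\<in>D. X \<subseteq> Z \<and> Y \<subseteq> Z" if XY: "X \<in> D" "Y \<in> D" for X Y
  proof -
    from XY obtain A B where AB: "A \<in> F" "A \<subseteq> E" "B \<in> F" "B \<subseteq> E"
      and X: "X = upper_approx U R A" and Y: "Y = upper_approx U R B"
      unfolding D_def by blast
    from E AB obtain G where G: "G \<in> F" "G \<subseteq> E"
      and "A \<subseteq> upper_approx U R G" "B \<subseteq> upper_approx U R G"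
      by (rule CF_closed_family_directed)
    then have "X \<subseteq> upper_approx U R G" "Y \<subseteq> upper_approx U R G"
      unfolding X Y by (simp_all add: upper_approx_absorb)
    moreover have "upper_approx U R G \<in> D" using G unfolding D_def by blast
    ultimately show ?thesis by blast
  qed
  ultimately have "directed_in (CF_closed_order U R F) D"
    unfolding directed_in_def D_def by (auto intro: CF_closed_upper_approx)
  \<comment> \<open>Since \<open>way_below\<close> tests every supremum above \<open>E\<close>,
    covering \<open>E\<close> by \<open>D\<close> is enough.\<close>
  moreover have "E \<subseteq> \<Union>D"
  proof
    fix x assume "x \<in> E"
    with E obtain A where "A \<in> F" "A \<subseteq> E" "x \<in> upper_approx U R A"
      by (rule CF_closed_elemE)
    then show "x \<in> \<Union>D" unfolding D_def by blast
  qed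
  ultimately have "\<exists>X\<in>D. E' \<subseteq> X"
    using wb CF_closed_directed_is_lub_Union[of U R F D] unfolding way_below_def by auto
  then show "CF_closed U R F E' \<and> (\<exists>A\<in>F. A \<subseteq> E \<and> E' \<subseteq> upper_approx U R A)"
    using wb unfolding way_below_def D_def by auto
next
  assume "CF_closed U R F E' \<and> (\<exists>A\<in>F. A \<subseteq> E \<and> E' \<subseteq> upper_approx U R A)"
  then obtain A where E': "CF_closed U R F E'"
    and A: "A \<in> F" "A \<subseteq> E" "E' \<subseteq> upper_approx U R A" by blast
  have "\<exists>X\<in>D. E' \<subseteq> X"
    if D: "directed_in (CF_closed_order U R F) D"
      and S: "is_lub (CF_closed_order U R F) S D" "E \<subseteq> S" for D S
  proof -
    have closed: "\<And>X. X \<in> D \<Longrightarrow> CF_closed U R F X"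
      using D unfolding directed_in_def by auto
    \<comment> \<open>The union is itself a CF-closed bound of \<open>D\<close>, so the least bound
      \<open>S\<close> lies inside it; finite subsets of \<open>S\<close> are then caught by members
      of \<open>D\<close>.\<close>
    have "S \<subseteq> \<Union>D"
      using S(1) CF_closed_directed_is_lub_Union[OF D]
        is_lub_CF_closed_order_iff[of D, OF closed] by blast
    then have "A \<subseteq> \<Union>D" using A S by blast
    then obtain X where "X \<in> D" "A \<subseteq> X"
      using finite_subset_directed_Union[of A D] finite_family[OF A(1)] D
      unfolding directed_in_def by auto
    then show ?thesis using upper_approx_subset_CF_closed[of X A] closed A by blast
  qed
  then show "way_below (CF_closed_order U R F) E' E"
    unfolding way_below_def using E E' by auto
qed

lemma continuous_domain_CF_closed_order: "continuous_domain (CF_closed_order U R F)"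
proof -
  interpret dcpo "CF_closed_order U R F" by (rule dcpo_CF_closed_order)
  show ?thesis
  proof unfold_locales
    fix E assume "E \<in> carrier (CF_closed_order U R F)"
    then have E: "CF_closed U R F E" by simp
    let ?W = "{E'. way_below (CF_closed_order U R F) E' E}"
    \<comment> \<open>These sets are cofinal in \<open>?W\<close>, so directedness and the union can
      be checked on them.\<close>
    have upper_approx_in: "upper_approx U R A \<in> ?W" if "A \<in> F" "A \<subseteq> E" for A
      using that by (auto simp: way_below_CF_closed_order_iff[OF E] intro: CF_closed_upper_approx)
    have closed: "CF_closed U R F X" if "X \<in> ?W" for X
      using that by (simp add: way_below_CF_closed_order_iff[OF E])
    have "\<exists>Z\<in>?W. X \<subseteq> Z \<and> Y \<subseteq> Z" if XY: "X \<in> ?W" "Y \<in> ?W" for X Y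
    proof -
      from XY obtain A B where AB: "A \<in> F" "A \<subseteq> E" "B \<in> F" "B \<subseteq> E"
        and X: "X \<subseteq> upper_approx U R A" and Y: "Y \<subseteq> upper_approx U R B"
        by (auto simp: way_below_CF_closed_order_iff[OF E])
      from E AB obtain G where G: "G \<in> F" "G \<subseteq> E"
        and "A \<subseteq> upper_approx U R G" "B \<subseteq> upper_approx U R G"
        by (rule CF_closed_family_directed)
      then have "X \<subseteq> upper_approx U R G" "Y \<subseteq> upper_approx U R G"
        using X Y upper_approx_absorb by blast+
      with upper_approx_in[OF G] show ?thesis by blast
    qed
    moreover have "?W \<noteq> {}"
      using E by (rule CF_closed_family_memberE) (use upper_approx_in in blast)
    ultimately show directed: "directed_in (CF_closed_order U R F) ?W"
      using closed unfolding directed_in_def by auto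
    have "\<Union>?W = E"
    proof
      show "\<Union>?W \<subseteq> E"
        using upper_approx_subset_CF_closed[OF E]
        by (fastforce simp: way_below_CF_closed_order_iff[OF E])
      show "E \<subseteq> \<Union>?W"
      proof
        fix x assume "x \<in> E"
        with E obtain A where "A \<in> F" "A \<subseteq> E" "x \<in> upper_approx U R A"
          by (rule CF_closed_elemE)
        with upper_approx_in show "x \<in> \<Union>?W" by blast
      qed
    qed
    with CF_closed_directed_is_lub_Union[OF directed]
    show "is_lub (CF_closed_order U R F) E ?W" by simp
  qed
qed

text \<open>
  Admissibility of \<open>G\<close> asks for a common bound \<open>B \<subseteq> X\<close> in \<open>F\<close> rather than only for
  \<open>upper_approx U R G \<subseteq> X\<close>, because condition sL compares sets below one
  \<open>upper_approx U R B\<close> only.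
\<close>

definition admissible :: "'a set \<Rightarrow> 'a set \<Rightarrow> 'a set \<Rightarrow> bool" where
  "admissible X M G \<longleftrightarrow> G \<in> F \<and> upper_approx U R M \<subseteq> upper_approx U R G \<and>
     (\<exists>B\<in>F. B \<subseteq> X \<and> upper_approx U R G \<subseteq> upper_approx U R B)"

text \<open>Competitors \<open>G'\<close> may have bounds of their own, so this asks for more than
  the leastness that sL gives below one fixed bound.\<close>

definition least_admissible :: "'a set \<Rightarrow> 'a set \<Rightarrow> 'a set \<Rightarrow> bool" where
  "least_admissible X M G \<longleftrightarrow> admissible X M G \<and>
     (\<forall>G'. admissible X M G' \<longrightarrow> upper_approx U R G \<subseteq> upper_approx U R G')"

end

section \<open>Suprema in principal ideals\<close>

context sL_approximation_space
begin

lemma least_admissible_exists: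
  assumes X: "CF_closed U R F X" and A: "A\<^sub>1 \<in> F" "A\<^sub>1 \<subseteq> X" "A\<^sub>2 \<in> F" "A\<^sub>2 \<subseteq> X"
  shows "\<exists>G. least_admissible X (A\<^sub>1 \<union> A\<^sub>2) G"
proof -
  let ?u = "upper_approx U R" and ?M = "A\<^sub>1 \<union> A\<^sub>2"
  have "?M = \<Union>{A\<^sub>1, A\<^sub>2}" by simp
  then have M: "?M \<in> join_saturation F"
    using A unfolding join_saturation_def
    by (metis (mono_tags, lifting) empty_not_insert empty_subsetI finite.intros
        insert_subset mem_Collect_eq)
  from X A obtain B where B: "B \<in> F" "B \<subseteq> X" "A\<^sub>1 \<subseteq> ?u B" "A\<^sub>2 \<subseteq> ?u B"
    by (rule CF_closed_family_directed)
  then have "?M \<subseteq> ?u B" by simp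
  from sL[OF M B(1) this] obtain G where G: "G \<in> F" "?u ?M \<subseteq> ?u G" "?u G \<subseteq> ?u B"
    and G_least: "\<And>G'. G' \<in> F \<Longrightarrow> ?u ?M \<subseteq> ?u G' \<Longrightarrow> ?u G' \<subseteq> ?u B \<Longrightarrow> ?u G \<subseteq> ?u G'"
    by metis
  have "?u G \<subseteq> ?u G'" if "admissible X ?M G'" for G'
  proof -
    from that obtain B' where G': "G' \<in> F" "?u ?M \<subseteq> ?u G'" "?u G' \<subseteq> ?u B'"
      and B': "B' \<in> F" "B' \<subseteq> X"
      unfolding admissible_def by blast
    \<comment> \<open>sL compares only within one approximation, so \<open>B\<close> and
      \<open>B'\<close> are placed under a common \<open>C\<close>, and a new least \<open>H\<close>
      is taken below \<open>C\<close>.\<close>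
    from X B(1,2) B' obtain C where C: "C \<in> F" "C \<subseteq> X" "B \<subseteq> ?u C" "B' \<subseteq> ?u C"
      by (rule CF_closed_family_directed)
    then have BC: "?u B \<subseteq> ?u C" "?u B' \<subseteq> ?u C"
      by (simp_all add: upper_approx_absorb)
    then have "?M \<subseteq> ?u C" using \<open>?M \<subseteq> ?u B\<close> by blast
    from sL[OF M C(1) this] obtain H where H: "H \<in> F" "?u ?M \<subseteq> ?u H"
      and H_least: "\<And>G'. G' \<in> F \<Longrightarrow> ?u ?M \<subseteq> ?u G' \<Longrightarrow> ?u G' \<subseteq> ?u C \<Longrightarrow> ?u H \<subseteq> ?u G'"
      by metis
    have "?u H \<subseteq> ?u G'" using H_least G' BC by blast
    \<comment> \<open>\<open>?u H\<close> lies inside \<open>?u G\<close>, hence inside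
      \<open>?u B\<close>, so \<open>H\<close> competes with \<open>G\<close> there; leastness of
      \<open>G\<close> forces \<open>?u G = ?u H\<close>.\<close>
    moreover have "?u H \<subseteq> ?u G" using H_least G BC by blast
    with G_least H G have "?u G \<subseteq> ?u H" by blast
    ultimately show ?thesis by blast
  qed
  then show ?thesis
    using G B unfolding least_admissible_def admissible_def by blast
qed

lemma binary_sup_below:
  assumes X: "CF_closed U R F X"
    and E\<^sub>1: "CF_closed U R F E\<^sub>1" "E\<^sub>1 \<subseteq> X" and E\<^sub>2: "CF_closed U R F E\<^sub>2" "E\<^sub>2 \<subseteq> X"
  obtains S where "CF_closed U R F S" "S \<subseteq> X" "E\<^sub>1 \<subseteq> S" "E\<^sub>2 \<subseteq> S"
    and "\<And>Y. CF_closed U R F Y \<Longrightarrow> Y \<subseteq> X \<Longrightarrow> E\<^sub>1 \<subseteq> Y \<Longrightarrow> E\<^sub>2 \<subseteq> Y \<Longrightarrow> S \<subseteq> Y"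
proof
  let ?u = "upper_approx U R"
  define D where "D = {?u G | G. \<exists>A\<^sub>1\<in>F. \<exists>A\<^sub>2\<in>F. A\<^sub>1 \<subseteq> E\<^sub>1 \<and> A\<^sub>2 \<subseteq> E\<^sub>2 \<and>
    least_admissible X (A\<^sub>1 \<union> A\<^sub>2) G}"
  have D_E: "\<exists>G A\<^sub>1 A\<^sub>2. Z = ?u G \<and> A\<^sub>1 \<in> F \<and> A\<^sub>2 \<in> F \<and> A\<^sub>1 \<subseteq> E\<^sub>1 \<and> A\<^sub>2 \<subseteq> E\<^sub>2 \<and>
    least_admissible X (A\<^sub>1 \<union> A\<^sub>2) G" if "Z \<in> D" for Z
    using that unfolding D_def by blast
  have D_I: "\<exists>G. ?u G \<in> D \<and> least_admissible X (A\<^sub>1 \<union> A\<^sub>2) G \<and> ?u A\<^sub>1 \<subseteq> ?u G \<and> ?u A\<^sub>2 \<subseteq> ?u G"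
    if A: "A\<^sub>1 \<in> F" "A\<^sub>1 \<subseteq> E\<^sub>1" "A\<^sub>2 \<in> F" "A\<^sub>2 \<subseteq> E\<^sub>2" for A\<^sub>1 A\<^sub>2
  proof -
    have "A\<^sub>1 \<subseteq> X" "A\<^sub>2 \<subseteq> X" using A E\<^sub>1 E\<^sub>2 by auto
    with X A obtain G where G: "least_admissible X (A\<^sub>1 \<union> A\<^sub>2) G"
      using least_admissible_exists by blast
    with A have "?u G \<in> D" unfolding D_def by blast
    moreover have "?u A\<^sub>1 \<subseteq> ?u G" "?u A\<^sub>2 \<subseteq> ?u G"
      using G unfolding least_admissible_def admissible_def upper_approx_Un by auto
    ultimately show ?thesis using G by blast
  qed
  \<comment> \<open>These fixed members make \<open>D\<close> nonempty and complete a pair when only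
    one of \<open>E\<^sub>1\<close> and \<open>E\<^sub>2\<close> contributes a set.\<close>
  obtain B\<^sub>1 where B\<^sub>1: "B\<^sub>1 \<in> F" "B\<^sub>1 \<subseteq> E\<^sub>1"
    using E\<^sub>1(1) by (rule CF_closed_family_memberE)
  obtain B\<^sub>2 where B\<^sub>2: "B\<^sub>2 \<in> F" "B\<^sub>2 \<subseteq> E\<^sub>2"
    using E\<^sub>2(1) by (rule CF_closed_family_memberE)
  show "CF_closed U R F (\<Union>D)"
  proof (rule CF_closed_directed_Union)
    show "CF_closed U R F Z" if "Z \<in> D" for Z
      using D_E[OF that] CF_closed_upper_approx
      unfolding least_admissible_def admissible_def by blast
    show "D \<noteq> {}" using D_I[OF B\<^sub>1 B\<^sub>2] by blast
  next
    fix Z Z' assume "Z \<in> D" "Z' \<in> D"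
    then obtain G A\<^sub>1 A\<^sub>2 G' A\<^sub>1' A\<^sub>2' where Z: "Z = ?u G" and Z': "Z' = ?u G'"
      and A: "A\<^sub>1 \<in> F" "A\<^sub>1 \<subseteq> E\<^sub>1" "A\<^sub>2 \<in> F" "A\<^sub>2 \<subseteq> E\<^sub>2"
      and A': "A\<^sub>1' \<in> F" "A\<^sub>1' \<subseteq> E\<^sub>1" "A\<^sub>2' \<in> F" "A\<^sub>2' \<subseteq> E\<^sub>2"
      and G: "least_admissible X (A\<^sub>1 \<union> A\<^sub>2) G"
      and G': "least_admissible X (A\<^sub>1' \<union> A\<^sub>2') G'"
      using D_E by meson
    from E\<^sub>1(1) A(1,2) A'(1,2) obtain C\<^sub>1 where C\<^sub>1: "C\<^sub>1 \<in> F" "C\<^sub>1 \<subseteq> E\<^sub>1"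
      and "A\<^sub>1 \<subseteq> ?u C\<^sub>1" "A\<^sub>1' \<subseteq> ?u C\<^sub>1"
      by (rule CF_closed_family_directed)
    then have 1: "?u A\<^sub>1 \<subseteq> ?u C\<^sub>1" "?u A\<^sub>1' \<subseteq> ?u C\<^sub>1"
      by (simp_all add: upper_approx_absorb)
    from E\<^sub>2(1) A(3,4) A'(3,4) obtain C\<^sub>2 where C\<^sub>2: "C\<^sub>2 \<in> F" "C\<^sub>2 \<subseteq> E\<^sub>2"
      and "A\<^sub>2 \<subseteq> ?u C\<^sub>2" "A\<^sub>2' \<subseteq> ?u C\<^sub>2"
      by (rule CF_closed_family_directed)
    then have 2: "?u A\<^sub>2 \<subseteq> ?u C\<^sub>2" "?u A\<^sub>2' \<subseteq> ?u C\<^sub>2"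
      by (simp_all add: upper_approx_absorb)
    from D_I[OF C\<^sub>1 C\<^sub>2] obtain H where H: "?u H \<in> D" "least_admissible X (C\<^sub>1 \<union> C\<^sub>2) H"
      "?u C\<^sub>1 \<subseteq> ?u H" "?u C\<^sub>2 \<subseteq> ?u H" by blast
    \<comment> \<open>\<open>H\<close> keeps its bound in \<open>X\<close> and dominates the smaller
      approximations, so it competes with both \<open>G\<close> and \<open>G'\<close>: enlarging the
      pair enlarges the least set.\<close>
    with 1 2 have "admissible X (A\<^sub>1 \<union> A\<^sub>2) H" "admissible X (A\<^sub>1' \<union> A\<^sub>2') H"
      unfolding least_admissible_def admissible_def upper_approx_Un by blast+
    with G G' have "Z \<subseteq> ?u H" "Z' \<subseteq> ?u H"
      unfolding least_admissible_def Z Z' by blast+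
    with H(1) show "\<exists>Y\<in>D. Z \<subseteq> Y \<and> Z' \<subseteq> Y" by blast
  qed
  show "E\<^sub>1 \<subseteq> \<Union>D"
  proof
    fix x assume "x \<in> E\<^sub>1"
    with E\<^sub>1(1) obtain A where "A \<in> F" "A \<subseteq> E\<^sub>1" "x \<in> ?u A" by (rule CF_closed_elemE)
    with D_I[OF this(1,2) B\<^sub>2] show "x \<in> \<Union>D" by blast
  qed
  show "E\<^sub>2 \<subseteq> \<Union>D"
  proof
    fix x assume "x \<in> E\<^sub>2"
    with E\<^sub>2(1) obtain A where "A \<in> F" "A \<subseteq> E\<^sub>2" "x \<in> ?u A" by (rule CF_closed_elemE)
    with D_I[OF B\<^sub>1 this(1,2)] show "x \<in> \<Union>D" by blast
  qed
  show least: "\<Union>D \<subseteq> Y" if Y: "CF_closed U R F Y" "Y \<subseteq> X" "E\<^sub>1 \<subseteq> Y" "E\<^sub>2 \<subseteq> Y" for Y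
  proof (rule Union_least)
    fix Z assume "Z \<in> D"
    then obtain G A\<^sub>1 A\<^sub>2 where Z: "Z = ?u G" and A: "A\<^sub>1 \<in> F" "A\<^sub>2 \<in> F" "A\<^sub>1 \<subseteq> E\<^sub>1" "A\<^sub>2 \<subseteq> E\<^sub>2"
      and G: "least_admissible X (A\<^sub>1 \<union> A\<^sub>2) G"
      using D_E by meson
    have "A\<^sub>1 \<subseteq> Y" "A\<^sub>2 \<subseteq> Y" using A Y by auto
    from Y(1) A(1) this(1) A(2) this(2) obtain B where B: "B \<in> F" "B \<subseteq> Y"
      and "A\<^sub>1 \<subseteq> ?u B" "A\<^sub>2 \<subseteq> ?u B"
      by (rule CF_closed_family_directed)
    then have "?u (A\<^sub>1 \<union> A\<^sub>2) \<subseteq> ?u B" by (simp add: upper_approx_absorb)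
    \<comment> \<open>\<open>B\<close> serves as its own bound because
      \<open>B \<subseteq> Y \<subseteq> X\<close>; the least set therefore lies inside
      \<open>?u B\<close>, and so inside \<open>Y\<close>.\<close>
    with B Y(2) have "admissible X (A\<^sub>1 \<union> A\<^sub>2) B" unfolding admissible_def by blast
    with G have "Z \<subseteq> ?u B" unfolding least_admissible_def Z by blast
    then show "Z \<subseteq> Y" using upper_approx_subset_CF_closed[OF Y(1) B] by blast
  qed
  \<comment> \<open>\<open>X\<close> is itself an upper bound, so this is the case
    \<open>Y = X\<close> of \<open>least\<close>.\<close>
  show "\<Union>D \<subseteq> X" using least X E\<^sub>1(2) E\<^sub>2(2) by blast
qed

lemma upper_semilattice_principal_ideal:
  assumes X: "CF_closed U R F X"
  shows "upper_semilattice (principal_ideal_order (CF_closed_order U R F) X)"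
proof -
  let ?P = "principal_ideal_order (CF_closed_order U R F) X"
  interpret partial_order ?P
    by (intro partial_order_principal_ideal_order partial_order_CF_closed_order)
  have carrier: "carrier ?P = {E. CF_closed U R F E \<and> E \<subseteq> X}"
    and le: "\<And>E E'. E \<sqsubseteq>\<^bsub>?P\<^esub> E' \<longleftrightarrow> E \<subseteq> E'"
    unfolding principal_ideal_order_def by simp_all
  show ?thesis
  proof unfold_locales
    fix E\<^sub>1 E\<^sub>2 assume "E\<^sub>1 \<in> carrier ?P" "E\<^sub>2 \<in> carrier ?P"
    then have "CF_closed U R F E\<^sub>1" "E\<^sub>1 \<subseteq> X" "CF_closed U R F E\<^sub>2" "E\<^sub>2 \<subseteq> X"
      unfolding carrier by auto
    with X obtain S where "CF_closed U R F S" "S \<subseteq> X" "E\<^sub>1 \<subseteq> S" "E\<^sub>2 \<subseteq> S"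
      and "\<And>Y. CF_closed U R F Y \<Longrightarrow> Y \<subseteq> X \<Longrightarrow> E\<^sub>1 \<subseteq> Y \<Longrightarrow> E\<^sub>2 \<subseteq> Y \<Longrightarrow> S \<subseteq> Y"
      by (rule binary_sup_below) blast
    \<comment> \<open>Upper bounds in \<open>?P\<close> are CF-closed sets contained in
      \<open>X\<close>, exactly the range of \<open>Y\<close> in the leastness of
      \<open>S\<close>.\<close>
    with \<open>E\<^sub>1 \<in> carrier ?P\<close> \<open>E\<^sub>2 \<in> carrier ?P\<close> show "\<exists>S. is_lub ?P S {E\<^sub>1, E\<^sub>2}"
      unfolding least_def Upper_def carrier le by (intro exI[of _ S]) auto
  qed
qed

end

theorem theorem4p12:
  fixes U :: "'a set" and R :: "('a \<times> 'a) set" and F :: "'a set set"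
  assumes "sL_approximation_space U R F"
  shows "sL_domain (CF_closed_order U R F)"
proof -
  interpret sL_approximation_space U R F by fact
  show ?thesis
    by (intro sL_domain.intro sL_domain_axioms.intro continuous_domain_CF_closed_order
        upper_semilattice_principal_ideal) simp
qed

end
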